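(* Let $r\ge0$ be an integer and let $u:\mathbb{Z}\times\mathbb{Z}\to\mathbb{C}$ satisfy $$u(n,t+1)+u(n,t-1)=u(n+1,t)+u(n-1,t)\qquad(n,t\in\mathbb{Z})$$ with standard initial conditions $f,g:\mathbb{Z}\to\mathbb{C}$, i.e. $u(n,0)=f(n)$ and $\frac{u(n,1)-u(n,-1)}{2}=g(n)$ for all $n$. Suppose $f$ is supported on $|n|\le r$ and $g$ is supported on $|n|\le r+1$. Then $u(\cdot,t)$ is supported on $|n|\le r+|t|$ for all $t\in\mathbb{Z}$. *)

theory Defs
  imports Complex_Main
begin

definition discrete_wave :: "(int \<Rightarrow> int \<Rightarrow> complex) \<Rightarrow> bool" where
  "discrete_wave u \<longleftrightarrow> (\<forall>n t. u n (t + 1) + u n (t - 1) = u (n + 1) t + u (n - 1) t)"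

text \<open>The initial velocity is the centred difference at time 0, not the one-step
  difference \<open>u n 1 - u n 0\<close>.\<close>

definition standard_initial_conditions ::
    "(int \<Rightarrow> int \<Rightarrow> complex) \<Rightarrow> (int \<Rightarrow> complex) \<Rightarrow> (int \<Rightarrow> complex) \<Rightarrow> bool" where
  "standard_initial_conditions u f g \<longleftrightarrow>
     (\<forall>n. u n 0 = f n) \<and> (\<forall>n. (u n 1 - u n (-1)) / 2 = g n)"

definition supported_on :: "(int \<Rightarrow> complex) \<Rightarrow> int set \<Rightarrow> bool" where
  "supported_on h S \<longleftrightarrow> {n. h n \<noteq> 0} \<subseteq> S"

end

theory Submission
  imports Defs
begin

text \<open>The equation expresses \<open>u n (t + 1)\<close> through values at times \<open>t\<close> and \<open>t - 1\<close> at
  positions within distance one of \<open>n\<close>, so information travels at speed at most one. Hence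
  two consecutive time slices with supports of radius \<open>r\<close> and \<open>r + 1\<close> force radius \<open>r + k\<close>
  at each later time \<open>k\<close> (\<open>wave_support_forward\<close>). The centred initial data yield such
  slices: at \<open>t = 0\<close> the equation gives the sum \<open>u n 1 + u n (-1)\<close> in terms of \<open>f\<close>, and
  \<open>g\<close> gives half the difference, so both slices adjacent to time 0 vanish for
  \<open>\<bar>n\<bar> > r + 1\<close>. Negative times follow because the equation is invariant under time
  reversal.\<close>

lemma supported_onD: "h n = 0" if "supported_on h S" "n \<notin> S"
  using that by (auto simp: supported_on_def)

lemma discrete_wave_next:
  assumes "discrete_wave u"
  shows "u n (t + 1) = u (n + 1) t + u (n - 1) t - u n (t - 1)"
  using assms unfolding discrete_wave_def by (simp add: eq_diff_eq)

lemma discrete_wave_reverse: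
  assumes "discrete_wave u"
  shows "discrete_wave (\<lambda>n t. u n (- t))"
  unfolding discrete_wave_def
proof (intro allI)
  fix n t :: int
  have shift: "- (t + 1) = - t - 1" "- (t - 1) = - t + 1"
    by simp_all
  have "u n (- t - 1) + u n (- t + 1) = u (n + 1) (- t) + u (n - 1) (- t)"
    using discrete_wave_next[OF assms, of n "- t"] by simp
  then show "u n (- (t + 1)) + u n (- (t - 1)) = u (n + 1) (- t) + u (n - 1) (- t)"
    unfolding shift .
qed

text \<open>Strong induction on time. If \<open>k \<ge> 2\<close> and \<open>\<bar>n\<bar> > r + k\<close>, then \<open>n + 1\<close> and \<open>n - 1\<close> lie outside
  radius \<open>r + (k - 1)\<close>, and \<open>n\<close> lies outside radius \<open>r + (k - 2)\<close>, so all three terms of the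
  recursion for \<open>u n k\<close> vanish.\<close>

lemma wave_support_forward:
  assumes wave: "discrete_wave u"
    and slice0: "\<And>n. \<bar>n\<bar> > r \<Longrightarrow> u n 0 = 0"
    and slice1: "\<And>n. \<bar>n\<bar> > r + 1 \<Longrightarrow> u n 1 = 0"
    and "\<bar>n\<bar> > r + int k"
  shows "u n (int k) = 0"
  using assms(4)
proof (induction k arbitrary: n rule: less_induct)
  case (less k)
  consider "k = 0" | "k = 1" | j where "k = j + 2"
    by (metis add_2_eq_Suc' One_nat_def not0_implies_Suc)
  then show ?case
  proof cases
    case 1
    then show ?thesis using slice0 less.prems by simp
  next
    case 2
    then show ?thesis using slice1 less.prems by simp
  next
    case 3
    have "u (n + 1) (int (j + 1)) = 0" "u (n - 1) (int (j + 1)) = 0" "u n (int j) = 0"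
      using less.prems 3 by (intro less.IH; simp)+
    with discrete_wave_next[OF wave, of n "int (j + 1)"] 3 show ?thesis
      by (simp add: add.commute)
  qed
qed

text \<open>At time 0 the wave equation gives the sum of the two neighbouring slices and the initial
  velocity gives half their difference, which together determine both.\<close>

lemma wave_slices_adjacent_to_zero:
  assumes wave: "discrete_wave u"
    and init: "standard_initial_conditions u f g"
  shows "u n 1 = (f (n + 1) + f (n - 1)) / 2 + g n"
    and "u n (- 1) = (f (n + 1) + f (n - 1)) / 2 - g n"
proof -
  have plus: "u n 1 + u n (- 1) = f (n + 1) + f (n - 1)"
    using discrete_wave_next[OF wave, of n 0] init
    by (simp add: standard_initial_conditions_def)
  have minus: "g n = (u n 1 - u n (- 1)) / 2"
    using init by (simp add: standard_initial_conditions_def)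
  show "u n 1 = (f (n + 1) + f (n - 1)) / 2 + g n"
    and "u n (- 1) = (f (n + 1) + f (n - 1)) / 2 - g n"
    by (simp_all only: plus[symmetric] minus) (simp_all add: field_simps)
qed

theorem corollary2p5:
  fixes r :: int
    and u :: "int \<Rightarrow> int \<Rightarrow> complex"
    and f g :: "int \<Rightarrow> complex"
  assumes "r \<ge> 0"
    and "discrete_wave u"
    and "standard_initial_conditions u f g"
    and "supported_on f {n. \<bar>n\<bar> \<le> r}"
    and "supported_on g {n. \<bar>n\<bar> \<le> r + 1}"
  shows "\<forall>t. supported_on (\<lambda>n. u n t) {n. \<bar>n\<bar> \<le> r + \<bar>t\<bar>}"
proof -
  have f0: "f n = 0" if "\<bar>n\<bar> > r" for n
    using supported_onD[OF assms(4), of n] that by simp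
  have g0: "g n = 0" if "\<bar>n\<bar> > r + 1" for n
    using supported_onD[OF assms(5), of n] that by simp
  have slice0: "u n 0 = 0" if "\<bar>n\<bar> > r" for n
    using f0 that assms(3) by (simp add: standard_initial_conditions_def)
  have slices: "u n 1 = 0" "u n (- 1) = 0" if "\<bar>n\<bar> > r + 1" for n
  proof -
    have "f (n + 1) = 0" "f (n - 1) = 0"
      using that by (intro f0; simp)+
    then show "u n 1 = 0" "u n (- 1) = 0"
      using wave_slices_adjacent_to_zero[OF assms(2,3), of n] g0[OF that] by simp_all
  qed
  have forward: "u n (int k) = 0" if "\<bar>n\<bar> > r + int k" for n and k :: nat
    using wave_support_forward[OF assms(2) slice0 slices(1) that] .
  have backward: "u n (- int k) = 0" if "\<bar>n\<bar> > r + int k" for n and k :: nat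
    using wave_support_forward[OF discrete_wave_reverse[OF assms(2)],
        where r = r and n = n and k = k] slice0 slices(2) that by simp
  have "u n t = 0" if "\<bar>n\<bar> > r + \<bar>t\<bar>" for n t
    using forward[where n = n and k = "nat \<bar>t\<bar>"]
      backward[where n = n and k = "nat \<bar>t\<bar>"] that
    by (cases "t \<ge> 0") simp_all
  then show ?thesis
    unfolding supported_on_def by (auto simp: not_le[symmetric])
qed

end
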